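(* Let $\alpha>0$, $\beta>0$ and $\delta\in\mathbb{R}$, and consider on a neighbourhood of the origin of $\mathbb{R}^4$, with canonical coordinates $\boldsymbol{x}=(q_1,q_2,p_1,p_2)^T$, the Hamiltonian $$H=\frac12\left(\frac{p_1^2}{\alpha(\beta^2\cos^2 q_1+\sin^2 q_1)}+p_2^2+(q_2-\beta\sin q_1)^2+(\delta+1-\cos q_1)^2\right).$$ The origin is an equilibrium of the Hamiltonian system $\dot{\boldsymbol{x}}=\boldsymbol{J}\nabla H(\boldsymbol{x})$. Let $\boldsymbol{A}$ be the matrix of the linearization of this system at the origin. Its characteristic polynomial is $$\det[\boldsymbol{A}-\lambda\boldsymbol{I}]=\lambda^4+\frac{(\alpha+1)\beta^2+\delta}{\alpha\beta^2}\lambda^2+\frac{\delta}{\alpha\beta^2},$$ and the two roots $\sigma_1,\sigma_2$ of $$\sigma^2-\frac{(\alpha+1)\beta^2+\delta}{\alpha\beta^2}\,\sigma+\frac{\delta}{\alpha\beta^2}=0\qquad(\sigma=-\lambda^2)$$ are real, distinct and positive if and only if $\delta>0$. Consequently, if $\delta>0$, the equilibrium at the origin is linearly stable, the eigenvalues of $\boldsymbol{A}$ being four distinct purely imaginary numbers.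
   Context: $\boldsymbol{J}=\begin{pmatrix}0&\mathbb{I}_{2\times2}\\-\mathbb{I}_{2\times2}&0\end{pmatrix}$ is the standard symplectic matrix. An equilibrium is called linearly stable if the zero solution of the linearized system $\dot{\boldsymbol{x}}=\boldsymbol{A}\boldsymbol{x}$ is (Lyapunov) stable. Physical origin (not needed for the claim): a mass $m_1$ moves on the ellipse $(a\cos\varphi,b\sin\varphi)$, a mass $m_2$ moves on the line $y=d$, and they are joined by a Hookean spring. After rescaling, $\alpha=m_1/m_2$, $\beta=a/b$, $\delta=d/b-1$, so $\delta>0$ means $d>b$. *)

theory Defs
  imports "HOL-Analysis.Analysis"
begin

definition gradient :: "('a::real_inner \<Rightarrow> real) \<Rightarrow> 'a \<Rightarrow> 'a" where
  "gradient f x = (THE g. GDERIV f x :> g)"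

definition sympl_J :: "real^4^4" where
  "sympl_J = vector
    [vector [ 0,  0, 1, 0],
     vector [ 0,  0, 0, 1],
     vector [-1,  0, 0, 0],
     vector [ 0, -1, 0, 0]]"

definition hamiltonian_field :: "(real^4 \<Rightarrow> real) \<Rightarrow> real^4 \<Rightarrow> real^4" where
  "hamiltonian_field H x = sympl_J *v gradient H x"

text \<open>The phase space coordinates are \<open>x = (q\<^sub>1, q\<^sub>2, p\<^sub>1, p\<^sub>2)\<close>.  For
  \<open>\<beta> > 0\<close> the denominator vanishes nowhere, so \<open>H\<close> is defined on the whole space.\<close>

definition spring_H :: "real \<Rightarrow> real \<Rightarrow> real \<Rightarrow> real^4 \<Rightarrow> real" where
  "spring_H \<alpha> \<beta> \<delta> x =
    (let q1 = x $ 1; q2 = x $ 2; p1 = x $ 3; p2 = x $ 4 in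
      1 / 2 * (p1^2 / (\<alpha> * (\<beta>^2 * (cos q1)^2 + (sin q1)^2)) + p2^2
        + (q2 - \<beta> * sin q1)^2 + (\<delta> + 1 - cos q1)^2))"

definition solves_ode_on ::
  "(real \<Rightarrow> 'a::real_normed_vector) \<Rightarrow> ('a \<Rightarrow> 'a) \<Rightarrow> real set \<Rightarrow> bool" where
  "solves_ode_on x f I \<longleftrightarrow> (\<forall>t\<in>I. (x has_vector_derivative f (x t)) (at t within I))"

definition equilibrium :: "('a::real_normed_vector \<Rightarrow> 'a) \<Rightarrow> 'a \<Rightarrow> bool" where
  "equilibrium f x0 \<longleftrightarrow> f x0 = 0"

text \<open>The end time \<open>T\<close> is arbitrary, so that solutions which might cease to exist in
  finite time are constrained as well.\<close>

definition lyapunov_stable :: "('a::real_normed_vector \<Rightarrow> 'a) \<Rightarrow> 'a \<Rightarrow> bool" where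
  "lyapunov_stable f x0 \<longleftrightarrow> equilibrium f x0 \<and>
    (\<forall>\<epsilon>>0. \<exists>\<eta>>0. \<forall>T\<ge>0. \<forall>x. solves_ode_on x f {0..T} \<and> norm (x 0 - x0) < \<eta> \<longrightarrow>
      (\<forall>t\<in>{0..T}. norm (x t - x0) < \<epsilon>))"

definition linearly_stable :: "(real^'n \<Rightarrow> real^'n) \<Rightarrow> real^'n \<Rightarrow> bool" where
  "linearly_stable f x0 \<longleftrightarrow> equilibrium f x0 \<and>
    lyapunov_stable (\<lambda>y. jacobian f (at x0) *v y) 0"

definition eigenvalues :: "real^'n^'n \<Rightarrow> complex set" where
  "eigenvalues A =
    {z. \<exists>v. v \<noteq> 0 \<and> map_matrix complex_of_real A *v v = z *s v}"

end

theory Submission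
  imports Defs
begin

text \<open>At the origin the linearized field is Hamiltonian for the quadratic part \<open>Q\<close> of \<open>H\<close>, so
  \<open>Q\<close> is conserved along its solutions; completing the square as in
  \<open>Q = p\<^sub>1\<^sup>2/(\<alpha>\<beta>\<^sup>2) + p\<^sub>2\<^sup>2 + (q\<^sub>2 - \<beta> q\<^sub>1)\<^sup>2 + \<delta> q\<^sub>1\<^sup>2\<close> shows that \<open>Q\<close> is positive definite if \<open>\<delta> > 0\<close>,
  which gives stability without solving the system.  The quadratic in \<open>\<sigma>\<close> has discriminant greater
  than \<open>(1 - c)\<^sup>2\<close>, where \<open>c = \<delta>/(\<alpha>\<beta>\<^sup>2)\<close>, and the product of its roots is \<open>c\<close>.\<close>

section \<open>Linear algebra in dimension four: determinant and eigenvalues\<close>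

lemma vector_4 [simp]:
  "(vector [x, y, z, w] :: 'a::zero^4) $ 1 = x"
  "(vector [x, y, z, w] :: 'a::zero^4) $ 2 = y"
  "(vector [x, y, z, w] :: 'a::zero^4) $ 3 = z"
  "(vector [x, y, z, w] :: 'a::zero^4) $ 4 = w"
  unfolding vector_def by simp_all

text \<open>Each permutation of \<open>insert a S\<close> is a transposition involving
  \<open>a\<close> composed with a permutation of \<open>S\<close>. Applying this three times leaves
  24 explicit products, grouped here as the cofactor expansion along the first row.\<close>

lemma det_4:
  fixes A :: "'a::comm_ring_1^4^4"
  shows "det A =
      A$1$1 * (A$2$2 * A$3$3 * A$4$4 + A$2$3 * A$3$4 * A$4$2 + A$2$4 * A$3$2 * A$4$3
             - A$2$2 * A$3$4 * A$4$3 - A$2$3 * A$3$2 * A$4$4 - A$2$4 * A$3$3 * A$4$2)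
    - A$1$2 * (A$2$1 * A$3$3 * A$4$4 + A$2$3 * A$3$4 * A$4$1 + A$2$4 * A$3$1 * A$4$3
             - A$2$1 * A$3$4 * A$4$3 - A$2$3 * A$3$1 * A$4$4 - A$2$4 * A$3$3 * A$4$1)
    + A$1$3 * (A$2$1 * A$3$2 * A$4$4 + A$2$2 * A$3$4 * A$4$1 + A$2$4 * A$3$1 * A$4$2
             - A$2$1 * A$3$4 * A$4$2 - A$2$2 * A$3$1 * A$4$4 - A$2$4 * A$3$2 * A$4$1)
    - A$1$4 * (A$2$1 * A$3$2 * A$4$3 + A$2$2 * A$3$3 * A$4$1 + A$2$3 * A$3$1 * A$4$2
             - A$2$1 * A$3$3 * A$4$2 - A$2$2 * A$3$1 * A$4$3 - A$2$3 * A$3$2 * A$4$1)"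
proof -
  have f: "finite {2::4, 3, 4}" "1 \<notin> {2::4, 3, 4}" "finite {3::4, 4}" "2 \<notin> {3::4, 4}"
    "finite {4::4}" "3 \<notin> {4::4}"
    by auto
  show ?thesis
    unfolding det_def UNIV_4
    unfolding sum_over_permutations_insert[OF f(1,2)]
    unfolding sum_over_permutations_insert[OF f(3,4)]
    unfolding sum_over_permutations_insert[OF f(5,6)]
    unfolding permutes_sing
    by (simp add: sign_swap_id permutation_swap_id sign_compose sign_id permutation_compose
        swap_id_eq) (simp add: algebra_simps)
qed

text \<open>An eigenvector for \<open>z\<close> is a nonzero kernel vector of
  \<open>A - mat z\<close>, and a square matrix has one exactly when it is singular. This connects
  \<open>eigenvalues\<close> with the characteristic polynomial.\<close>

lemma mem_eigenvalues_iff: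
  "z \<in> eigenvalues A \<longleftrightarrow> det (map_matrix complex_of_real A - mat z) = 0"
proof -
  let ?M = "map_matrix complex_of_real A"
  have "(?M - mat z) *v v = ?M *v v - z *s v" for v
    by (simp add: matrix_vector_mult_diff_rdistrib) (simp add: matrix_vector_mult_def mat_def
        vec_eq_iff if_distrib if_distribR cong: if_cong)
  then have "z \<in> eigenvalues A \<longleftrightarrow> \<not> (\<forall>v. (?M - mat z) *v v = 0 \<longrightarrow> v = 0)"
    by (auto simp: eigenvalues_def)
  also have "\<dots> \<longleftrightarrow> \<not> invertible (?M - mat z)"
    by (simp add: matrix_left_invertible_ker invertible_left_inverse)
  finally show ?thesis
    by (simp add: invertible_det_nz)
qed

section \<open>Jacobians, gradients and conserved quantities\<close>

lemma has_derivative_vec_iff: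
  fixes f :: "'a::real_normed_vector \<Rightarrow> real^'n"
  shows "(f has_derivative f') (at x within S) \<longleftrightarrow>
    (\<forall>i. ((\<lambda>x. f x $ i) has_derivative (\<lambda>h. f' h $ i)) (at x within S))"
proof -
  have Basis: "(Basis :: (real^'n) set) = range (\<lambda>i. axis i 1)"
    unfolding Basis_vec_def Basis_real_def by blast
  show ?thesis
    unfolding has_derivative_componentwise_within[of f] Basis cart_eq_inner_axis by blast
qed

lemma jacobian_eqI:
  fixes f :: "real^'n \<Rightarrow> real^'m"
  assumes "(f has_derivative (\<lambda>h. M *v h)) (at x)"
  shows "jacobian f (at x) = M"
  by (simp add: jacobian_def flip: frechet_derivative_at[OF assms])

lemma gradient_eqI:
  assumes "GDERIV f x :> g"
  shows "gradient f x = g"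
  unfolding gradient_def
proof (rule the_equality)
  fix g' assume "GDERIV f x :> g'"
  then have "(\<lambda>h. inner h g') = (\<lambda>h. inner h g)"
    using assms unfolding gderiv_def by (rule has_derivative_unique)
  \<comment> \<open>Testing both functionals on the difference of the two candidates turns equality
    of derivatives into vanishing of a squared norm.\<close>
  from fun_cong[OF this, of "g' - g"] have "inner (g' - g) (g' - g) = 0"
    by (simp add: inner_diff_right)
  then show "g' = g"
    by simp
qed (fact assms)

text \<open>By the chain rule and \<open>cons\<close>, \<open>V\<close> is constant along solutions.
  Continuity at \<open>x0\<close> makes its initial value smaller than \<epsilon>^2, and
  \<open>bound\<close> turns this back into a distance at every later time. The resulting \<eta>
  depends neither on \<open>T\<close> nor on the solution.\<close>

lemma lyapunov_stable_if_conserved: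
  fixes f :: "'a::real_normed_vector \<Rightarrow> 'a" and V :: "'a \<Rightarrow> real"
  assumes eq: "f x0 = 0"
    and deriv: "\<And>y. (V has_derivative V' y) (at y)"
    and cons: "\<And>y. V' y (f y) = 0"
    and zero: "V x0 = 0"
    and bound: "\<And>y. (norm (y - x0))\<^sup>2 \<le> V y"
  shows "lyapunov_stable f x0"
  unfolding lyapunov_stable_def equilibrium_def
proof (intro conjI allI impI)
  fix \<epsilon> :: real assume "\<epsilon> > 0"
  have "isCont V x0"
    using deriv has_derivative_continuous by blast
  then obtain \<eta> where "\<eta> > 0" and \<eta>: "\<And>y. dist y x0 < \<eta> \<Longrightarrow> dist (V y) (V x0) < \<epsilon>\<^sup>2"
    using \<open>\<epsilon> > 0\<close> unfolding continuous_at_eps_delta by (metis zero_less_power dist_commute)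
  show "\<exists>\<eta>>0. \<forall>T\<ge>0. \<forall>x. solves_ode_on x f {0..T} \<and> norm (x 0 - x0) < \<eta> \<longrightarrow>
      (\<forall>t\<in>{0..T}. norm (x t - x0) < \<epsilon>)"
  proof (intro exI[of _ \<eta>] conjI allI impI ballI \<open>\<eta> > 0\<close>)
    fix T t :: real and x
    assume "0 \<le> T" and x: "solves_ode_on x f {0..T} \<and> norm (x 0 - x0) < \<eta>" and t: "t \<in> {0..T}"
    have "((\<lambda>s. V (x s)) has_vector_derivative 0) (at s within {0..T})" if "s \<in> {0..T}" for s
    proof -
      have "(x has_derivative (\<lambda>h. h *\<^sub>R f (x s))) (at s within {0..T})"
        using x that by (simp add: solves_ode_on_def has_vector_derivative_def)
      from has_derivative_compose[OF this deriv]
      have "((\<lambda>s. V (x s)) has_derivative (\<lambda>h. V' (x s) (h *\<^sub>R f (x s)))) (at s within {0..T})" .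
      moreover have "V' (x s) (h *\<^sub>R f (x s)) = 0" for h
        by (simp add: linear_scale[OF has_derivative_linear[OF deriv]] cons)
      ultimately show ?thesis
        by (simp add: has_vector_derivative_def)
    qed
    then obtain c where "\<And>s. s \<in> {0..T} \<Longrightarrow> V (x s) = c"
      using has_vector_derivative_zero_constant[of "{0..T}" "\<lambda>s. V (x s)"] by auto
    then have "V (x t) = V (x 0)"
      using t by auto
    also have "\<dots> < \<epsilon>\<^sup>2"
      using \<eta>[of "x 0"] x zero by (simp add: dist_norm)
    finally have "(norm (x t - x0))\<^sup>2 < \<epsilon>\<^sup>2"
      using bound le_less_trans by blast
    then show "norm (x t - x0) < \<epsilon>"
      using \<open>\<epsilon> > 0\<close> by (simp add: power_less_imp_less_base)
  qed
qed (fact eq)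

section \<open>The gradient of the Hamiltonian and the linearized field\<close>

lemma has_derivative_comp_vec_nth:
  fixes x :: "real^'n"
  assumes "(f has_real_derivative d) (at (x $ i))"
  shows "((\<lambda>x. f (x $ i)) has_derivative (\<lambda>h. d * h $ i)) (at x)"
  using has_derivative_compose[OF bounded_linear_imp_has_derivative[OF bounded_linear_vec_nth]
      assms[unfolded has_field_derivative_def]] .

lemmas has_derivative_vec_nth_intros =
  bounded_linear_imp_has_derivative[OF bounded_linear_vec_nth]
  has_derivative_comp_vec_nth[OF DERIV_sin] has_derivative_comp_vec_nth[OF DERIV_cos]
  has_derivative_add has_derivative_diff has_derivative_minus has_derivative_mult
  has_derivative_power has_derivative_const

text \<open>Squared speed of the curve (\<beta> sin t, cos t), the rescaled ellipse carrying the
  first mass.\<close>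

definition spring_metric :: "real \<Rightarrow> real \<Rightarrow> real" where
  "spring_metric \<beta> t = \<beta>\<^sup>2 * (cos t)\<^sup>2 + (sin t)\<^sup>2"

text \<open>Quotients are written as separate factors depending on \<open>q1\<close> alone, so that
  the product rule suffices when the field is differentiated once more.\<close>

definition spring_grad :: "real \<Rightarrow> real \<Rightarrow> real \<Rightarrow> real^4 \<Rightarrow> real^4" where
  "spring_grad \<alpha> \<beta> \<delta> x =
    (let q1 = x $ 1; q2 = x $ 2; p1 = x $ 3; p2 = x $ 4 in
      vector
       [p1\<^sup>2 * (- ((1 - \<beta>\<^sup>2) * sin q1 * cos q1 / (\<alpha> * (spring_metric \<beta> q1)\<^sup>2)))
          - (q2 - \<beta> * sin q1) * (\<beta> * cos q1) + (\<delta> + 1 - cos q1) * sin q1,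
        q2 - \<beta> * sin q1,
        p1 * (1 / (\<alpha> * spring_metric \<beta> q1)),
        p2])"

text \<open>This is \<open>sympl_J\<close> times the Hessian of the Hamiltonian at the origin: the
  inverse mass matrix above, minus the stiffness matrix below.\<close>

definition spring_lin :: "real \<Rightarrow> real \<Rightarrow> real \<Rightarrow> real^4^4" where
  "spring_lin \<alpha> \<beta> \<delta> = vector
    [vector [0, 0, 1 / (\<alpha> * \<beta>\<^sup>2), 0],
     vector [0, 0, 0, 1],
     vector [- (\<beta>\<^sup>2 + \<delta>), \<beta>, 0, 0],
     vector [\<beta>, - 1, 0, 0]]"

lemma spring_metric_pos:
  assumes "\<beta> \<noteq> 0"
  shows "0 < spring_metric \<beta> t"
proof -
  have "sin t \<noteq> 0 \<or> cos t \<noteq> 0"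
    using sin_zero_abs_cos_one[of t] by auto
  then have "\<beta> * cos t \<noteq> 0 \<or> sin t \<noteq> 0"
    using assms by auto
  then show ?thesis
    unfolding spring_metric_def power_mult_distrib[symmetric] by (simp only: sum_power2_gt_zero_iff)
qed

lemma DERIV_spring_metric:
  "(spring_metric \<beta> has_real_derivative 2 * (1 - \<beta>\<^sup>2) * sin t * cos t) (at t)"
  unfolding spring_metric_def[abs_def]
  by (rule derivative_eq_intros refl)+ (simp del: mult_cancel_left mult_cancel_right, algebra)

lemma DERIV_inverse_spring_metric:
  assumes "\<alpha> \<noteq> 0" and "\<beta> \<noteq> 0"
  shows "((\<lambda>t. 1 / (\<alpha> * spring_metric \<beta> t)) has_real_derivative
    - (2 * (1 - \<beta>\<^sup>2) * sin t * cos t / (\<alpha> * (spring_metric \<beta> t)\<^sup>2))) (at t)"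
proof -
  have "\<alpha> * spring_metric \<beta> t \<noteq> 0"
    using assms(1) spring_metric_pos[OF assms(2), of t] by simp
  from DERIV_inverse_fun[OF DERIV_cmult[OF DERIV_spring_metric] this]
  show ?thesis
    unfolding divide_inverse mult_1_left
    by (rule DERIV_cong) (use assms(1) in \<open>simp add: power2_eq_square\<close>)
qed

lemma GDERIV_spring_H:
  assumes "\<alpha> \<noteq> 0" and "\<beta> \<noteq> 0"
  shows "GDERIV (spring_H \<alpha> \<beta> \<delta>) x :> spring_grad \<alpha> \<beta> \<delta> x"
proof -
  \<comment> \<open>Division becomes multiplication by the reciprocal, whose derivative is already
    known, so no quotient rule is called for.\<close>
  have "spring_H \<alpha> \<beta> \<delta> = (\<lambda>x. 1 / 2 * ((x $ 3)\<^sup>2 * (1 / (\<alpha> * spring_metric \<beta> (x $ 1)))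
      + (x $ 4)\<^sup>2 + (x $ 2 - \<beta> * sin (x $ 1))\<^sup>2 + (\<delta> + 1 - cos (x $ 1))\<^sup>2))"
    by (simp add: fun_eq_iff spring_H_def spring_metric_def Let_def)
  moreover have "(\<dots> has_derivative (\<lambda>h. h \<bullet> spring_grad \<alpha> \<beta> \<delta> x)) (at x)"
    by (rule has_derivative_eq_rhs,
        (rule has_derivative_vec_nth_intros
          has_derivative_comp_vec_nth[OF DERIV_inverse_spring_metric[OF assms]])+,
        simp add: fun_eq_iff inner_vec_def sum_4 spring_grad_def Let_def)
      (simp add: algebra_simps)
  ultimately show ?thesis
    by (simp add: gderiv_def)
qed

lemma has_derivative_spring_field:
  assumes "\<alpha> \<noteq> 0" and "\<beta> \<noteq> 0"
  shows "(hamiltonian_field (spring_H \<alpha> \<beta> \<delta>) has_derivative (\<lambda>h. spring_lin \<alpha> \<beta> \<delta> *v h)) (at 0)"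
proof -
  \<comment> \<open>The factor \<open>p\<^sub>1\<^sup>2\<close> of \<open>?k\<close> vanishes to second order at the origin, so the value of its derivative
    \<open>k'\<close> is irrelevant.\<close>
  let ?k = "\<lambda>t. - ((1 - \<beta>\<^sup>2) * sin t * cos t / (\<alpha> * (spring_metric \<beta> t)\<^sup>2))"
  have "\<alpha> * (spring_metric \<beta> 0)\<^sup>2 \<noteq> 0"
    using assms by (simp add: spring_metric_def)
  then have "?k field_differentiable (at 0)"
    using DERIV_spring_metric
    by (intro derivative_intros) (auto simp: field_differentiable_def intro: DERIV_sin DERIV_cos)
  then obtain k' where k': "(?k has_real_derivative k') (at ((0 :: real^4) $ 1))"
    by (auto simp: field_differentiable_def)
  have "sympl_J *v g = vector [g $ 3, g $ 4, - g $ 1, - g $ 2]" for g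
    by (simp add: vec_eq_iff forall_4 matrix_vector_mult_def sum_4 sympl_J_def)
  then have field: "hamiltonian_field (spring_H \<alpha> \<beta> \<delta>) = (\<lambda>x. let g = spring_grad \<alpha> \<beta> \<delta> x in
      vector [g $ 3, g $ 4, - g $ 1, - g $ 2])"
    using gradient_eqI[OF GDERIV_spring_H[OF assms]]
    by (simp add: hamiltonian_field_def fun_eq_iff Let_def)
  \<comment> \<open>The rule for \<open>?k\<close> comes first, so that this term is differentiated
    as a whole before \<open>has_derivative_minus\<close> can split it.\<close>
  note intros = has_derivative_comp_vec_nth[OF k'] has_derivative_vec_nth_intros
    has_derivative_comp_vec_nth[OF DERIV_inverse_spring_metric[OF assms]]
  show ?thesis
    unfolding field has_derivative_vec_iff forall_4 Let_def spring_grad_def vector_4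
    by (intro conjI; rule has_derivative_eq_rhs, (rule intros)+)
      (simp_all add: fun_eq_iff spring_metric_def spring_lin_def matrix_vector_mult_def sum_4
        algebra_simps power2_eq_square)
qed

section \<open>Characteristic polynomial and stability of the linearized system\<close>

lemma det_spring_lin:
  assumes "\<alpha> \<noteq> 0" and "\<beta> \<noteq> 0"
  shows "det (map_matrix complex_of_real (spring_lin \<alpha> \<beta> \<delta>) - mat z) =
    z^4 + complex_of_real (((\<alpha> + 1) * \<beta>\<^sup>2 + \<delta>) / (\<alpha> * \<beta>\<^sup>2)) * z\<^sup>2
      + complex_of_real (\<delta> / (\<alpha> * \<beta>\<^sup>2))"
  using assms
  by (simp add: det_4 map_matrix_def spring_lin_def mat_def field_simps power2_eq_square power4_eq_xxxx)

lemma lyapunov_stable_spring_lin: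
  assumes "\<alpha> > 0" and "\<beta> > 0" and "\<delta> > 0"
  shows "lyapunov_stable (\<lambda>y. spring_lin \<alpha> \<beta> \<delta> *v y) 0"
proof -
  define a where "a = 1 / (\<alpha> * \<beta>\<^sup>2)"
  \<comment> \<open>The sum of the positive coefficients in the estimate of the squared norm below.
    It exceeds each of them, so \<open>K * Q\<close> dominates the squared norm.\<close>
  define K where "K = (1 + 2 * \<beta>\<^sup>2) / \<delta> + 2 + 1 / a"
  define Q :: "real^4 \<Rightarrow> real" where
    "Q y = a * (y $ 3)\<^sup>2 + (y $ 4)\<^sup>2 + (y $ 2 - \<beta> * y $ 1)\<^sup>2 + \<delta> * (y $ 1)\<^sup>2" for y
  define Q' :: "real^4 \<Rightarrow> real^4 \<Rightarrow> real" where
    "Q' y h = 2 * (a * y $ 3 * h $ 3 + y $ 4 * h $ 4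
      + (y $ 2 - \<beta> * y $ 1) * (h $ 2 - \<beta> * h $ 1) + \<delta> * y $ 1 * h $ 1)" for y h
  have "a > 0"
    using assms by (simp add: a_def)
  show ?thesis
  proof (rule lyapunov_stable_if_conserved[where V = "\<lambda>y. K * Q y" and V' = "\<lambda>y h. K * Q' y h"])
    show "((\<lambda>y. K * Q y) has_derivative (\<lambda>h. K * Q' y h)) (at y)" for y
      unfolding Q_def Q'_def
      by (auto intro!: derivative_eq_intros bounded_linear.has_derivative[OF bounded_linear_vec_nth]
          simp: fun_eq_iff algebra_simps)
    \<comment> \<open>Energy conservation: the terms containing \<open>y $ 3\<close> and those
      containing \<open>y $ 4\<close> cancel separately.\<close>
    show "K * Q' y (spring_lin \<alpha> \<beta> \<delta> *v y) = 0" for y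
      by (simp add: Q'_def spring_lin_def matrix_vector_mult_def sum_4 flip: a_def)
        (simp add: algebra_simps power2_eq_square)
    show "(norm (y - 0))\<^sup>2 \<le> K * Q y" for y
    proof -
      \<comment> \<open>This is (u + v)^2 \<le> 2 u^2 + 2 v^2 with u =
        \<open>y $ 2 - \<beta> * y $ 1\<close> and v = \<open>\<beta> * y $ 1\<close>; the two sides
        differ by (u - v)^2.\<close>
      have "(y $ 2)\<^sup>2 \<le> 2 * (y $ 2 - \<beta> * y $ 1)\<^sup>2 + 2 * \<beta>\<^sup>2 * (y $ 1)\<^sup>2"
        using zero_le_power2[of "y $ 2 - 2 * \<beta> * y $ 1"]
        by (simp add: power2_eq_square algebra_simps)
      moreover have "(1 + 2 * \<beta>\<^sup>2) / \<delta> * (\<delta> * (y $ 1)\<^sup>2) = (y $ 1)\<^sup>2 + 2 * \<beta>\<^sup>2 * (y $ 1)\<^sup>2"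
        using \<open>\<delta> > 0\<close> by (simp add: field_simps)
      ultimately have "(norm (y - 0))\<^sup>2 \<le>
          1 / a * (a * (y $ 3)\<^sup>2) + 2 * (y $ 4)\<^sup>2 + 2 * (y $ 2 - \<beta> * y $ 1)\<^sup>2
          + (1 + 2 * \<beta>\<^sup>2) / \<delta> * (\<delta> * (y $ 1)\<^sup>2)"
        using \<open>a > 0\<close>
        by (simp add: power2_norm_eq_inner inner_vec_def sum_4 add_increasing flip: power2_eq_square)
      also have "\<dots> \<le> K * (a * (y $ 3)\<^sup>2) + K * (y $ 4)\<^sup>2 + K * (y $ 2 - \<beta> * y $ 1)\<^sup>2
          + K * (\<delta> * (y $ 1)\<^sup>2)"
        using \<open>a > 0\<close> \<open>\<delta> > 0\<close>
        by (intro add_mono mult_right_mono) (auto simp: K_def)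
      finally show ?thesis
        by (simp add: Q_def algebra_simps)
    qed
  qed (simp_all add: Q_def)
qed

section \<open>Roots of the quadratic and of the biquadratic equation\<close>

lemma quadratic_two_positive_roots_iff:
  fixes b c :: real
  assumes "c > 0 \<Longrightarrow> b > 1 + c"
  shows "(\<exists>\<sigma>1 \<sigma>2 :: real. \<sigma>1 \<noteq> \<sigma>2 \<and> \<sigma>1 > 0 \<and> \<sigma>2 > 0 \<and>
      {\<sigma>::complex. \<sigma>\<^sup>2 - complex_of_real b * \<sigma> + complex_of_real c = 0} =
      {complex_of_real \<sigma>1, complex_of_real \<sigma>2}) \<longleftrightarrow> c > 0"
    (is "(\<exists>\<sigma>1 \<sigma>2. ?P \<sigma>1 \<sigma>2) \<longleftrightarrow> _")
proof
  assume "\<exists>\<sigma>1 \<sigma>2. ?P \<sigma>1 \<sigma>2"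
  then obtain s t where st: "s \<noteq> t" "s > 0" "t > 0"
    and roots: "{\<sigma>::complex. \<sigma>\<^sup>2 - complex_of_real b * \<sigma> + complex_of_real c = 0} =
      {complex_of_real s, complex_of_real t}"
    by blast
  have "r\<^sup>2 - b * r + c = 0" if "r \<in> {s, t}" for r
  proof -
    have "complex_of_real r \<in> {complex_of_real s, complex_of_real t}"
      using that by auto
    then have "complex_of_real (r\<^sup>2 - b * r + c) = 0"
      unfolding roots[symmetric] by simp
    then show ?thesis
      by (simp only: of_real_eq_0_iff)
  qed
  then have s: "s\<^sup>2 - b * s + c = 0" and t: "t\<^sup>2 - b * t + c = 0"
    by auto
  \<comment> \<open>Vieta's formulas: subtracting the two equations and cancelling
    \<open>s - t\<close> gives the sum of the roots, and then their product.\<close>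
  then have "(s - t) * (s + t - b) = 0"
    by (simp add: power2_eq_square algebra_simps)
  then have "b = s + t"
    using st by auto
  then have "c = s * t"
    using s by (simp add: power2_eq_square algebra_simps)
  then show "c > 0"
    using st by simp
next
  assume "c > 0"
  then have b: "b > 1 + c"
    by (rule assms)
  define r where "r = sqrt (b\<^sup>2 - 4 * c)"
  have "(1 + c)\<^sup>2 < b\<^sup>2"
    using b \<open>c > 0\<close> by (intro power_strict_mono) auto
  moreover have "(1 + c)\<^sup>2 - 4 * c = (1 - c)\<^sup>2"
    by (simp add: power2_eq_square algebra_simps)
  ultimately have "b\<^sup>2 - 4 * c > 0"
    using zero_le_power2[of "1 - c"] by linarith
  then have "r > 0" and r: "r\<^sup>2 = b\<^sup>2 - 4 * c"
    by (simp_all add: r_def)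
  \<comment> \<open>This makes the smaller root \<open>(b - r) / 2\<close> positive.\<close>
  have "r < b"
  proof (rule power2_less_imp_less)
    show "r\<^sup>2 < b\<^sup>2"
      using r \<open>c > 0\<close> by linarith
    show "0 \<le> b"
      using b \<open>c > 0\<close> by linarith
  qed
  have c: "c = (b - r) / 2 * ((b + r) / 2)"
    using r by (simp add: power2_eq_square field_simps)
  have "\<sigma>\<^sup>2 - complex_of_real b * \<sigma> + complex_of_real c =
      (\<sigma> - complex_of_real ((b - r) / 2)) * (\<sigma> - complex_of_real ((b + r) / 2))" for \<sigma>
    unfolding c by (simp add: power2_eq_square field_simps)
  then have "{\<sigma>::complex. \<sigma>\<^sup>2 - complex_of_real b * \<sigma> + complex_of_real c = 0} =
      {complex_of_real ((b - r) / 2), complex_of_real ((b + r) / 2)}"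
    by (simp only: mult_eq_0_iff right_minus_eq) blast
  then have "?P ((b - r) / 2) ((b + r) / 2)"
    using \<open>r > 0\<close> \<open>r < b\<close> by auto
  then show "\<exists>\<sigma>1 \<sigma>2. ?P \<sigma>1 \<sigma>2"
    by blast
qed

text \<open>Substituting \<sigma> = -z^2 reduces the biquadratic to the quadratic. Each positive
  root \<sigma> yields the pair z = i sqrt \<sigma>, z = -i sqrt \<sigma>, and distinct roots yield
  disjoint pairs.\<close>

lemma biquadratic_imaginary_roots:
  fixes b c s t :: real
  assumes "s \<noteq> t" and "s > 0" and "t > 0"
    and roots: "{\<sigma>::complex. \<sigma>\<^sup>2 - complex_of_real b * \<sigma> + complex_of_real c = 0} =
      {complex_of_real s, complex_of_real t}"
  defines "Z \<equiv> {z::complex. z^4 + complex_of_real b * z\<^sup>2 + complex_of_real c = 0}"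
  shows "card Z = 4" and "\<forall>z\<in>Z. \<exists>\<omega>::real. \<omega> \<noteq> 0 \<and> z = \<i> * complex_of_real \<omega>"
proof -
  let ?W = "{sqrt s, - sqrt s, sqrt t, - sqrt t}"
  have root: "- z\<^sup>2 = complex_of_real r \<longleftrightarrow>
      z \<in> (\<lambda>\<omega>. \<i> * complex_of_real \<omega>) ` {sqrt r, - sqrt r}" if "r > 0" for z r
  proof -
    \<comment> \<open>With \<open>- r\<close> written as a square, equality of squares leaves only
      the two signs.\<close>
    have "- z\<^sup>2 = complex_of_real r \<longleftrightarrow> z\<^sup>2 = (\<i> * complex_of_real (sqrt r))\<^sup>2"
      using that by (auto simp: power_mult_distrib minus_equation_iff simp flip: of_real_power)
    then show ?thesis
      by (simp add: power2_eq_iff)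
  qed
  have "z \<in> Z \<longleftrightarrow> - z\<^sup>2 \<in> {complex_of_real s, complex_of_real t}" for z
    unfolding roots[symmetric] Z_def by (simp flip: power_mult)
  then have Z: "Z = (\<lambda>\<omega>. \<i> * complex_of_real \<omega>) ` ?W"
    using root[OF \<open>s > 0\<close>] root[OF \<open>t > 0\<close>] by (simp add: set_eq_iff)
  have "card Z = card ?W"
    unfolding Z by (intro card_image inj_onI) simp
  also have "\<dots> = 4"
  proof -
    have "distinct [u, - u, v, - v]" if "u > 0" "v > 0" "u \<noteq> v" for u v :: real
      using that by auto
    then have "distinct [sqrt s, - sqrt s, sqrt t, - sqrt t]"
      by this (use assms(1-3) in simp_all)
    from distinct_card[OF this] show ?thesis
      by simp
  qed
  finally show "card Z = 4" .
  show "\<forall>z\<in>Z. \<exists>\<omega>::real. \<omega> \<noteq> 0 \<and> z = \<i> * complex_of_real \<omega>"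
    unfolding Z using \<open>s > 0\<close> \<open>t > 0\<close> by force
qed

theorem mainTheorem1:
  fixes \<alpha> \<beta> \<delta> :: real
    and X :: "real^4 \<Rightarrow> real^4"
    and A :: "real^4^4"
  assumes "\<alpha> > 0" and "\<beta> > 0"
  defines "X \<equiv> hamiltonian_field (spring_H \<alpha> \<beta> \<delta>)"
  defines "A \<equiv> jacobian X (at 0)"
  shows "(\<forall>x. spring_H \<alpha> \<beta> \<delta> differentiable (at x)) \<and> X differentiable (at 0)
    \<and> equilibrium X 0
    \<and> (\<forall>z::complex. det (map_matrix complex_of_real A - mat z) =
         z^4 + complex_of_real (((\<alpha> + 1) * \<beta>^2 + \<delta>) / (\<alpha> * \<beta>^2)) * z^2
           + complex_of_real (\<delta> / (\<alpha> * \<beta>^2)))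
    \<and> ((\<exists>\<sigma>1 \<sigma>2 :: real. \<sigma>1 \<noteq> \<sigma>2 \<and> \<sigma>1 > 0 \<and> \<sigma>2 > 0 \<and>
          {\<sigma>::complex. \<sigma>^2 - complex_of_real (((\<alpha> + 1) * \<beta>^2 + \<delta>) / (\<alpha> * \<beta>^2)) * \<sigma>
             + complex_of_real (\<delta> / (\<alpha> * \<beta>^2)) = 0} =
          {complex_of_real \<sigma>1, complex_of_real \<sigma>2})
        \<longleftrightarrow> \<delta> > 0)
    \<and> (\<delta> > 0 \<longrightarrow> linearly_stable X 0 \<and> card (eigenvalues A) = 4 \<and>
         (\<forall>z\<in>eigenvalues A. \<exists>\<omega>::real. \<omega> \<noteq> 0 \<and> z = \<i> * complex_of_real \<omega>))"
proof -
  let ?b = "((\<alpha> + 1) * \<beta>^2 + \<delta>) / (\<alpha> * \<beta>^2)" and ?c = "\<delta> / (\<alpha> * \<beta>^2)"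
  have nz: "\<alpha> \<noteq> 0" "\<beta> \<noteq> 0"
    using assms(1,2) by auto
  have diff_H: "\<forall>x. spring_H \<alpha> \<beta> \<delta> differentiable (at x)"
    using GDERIV_spring_H[OF nz] unfolding gderiv_def differentiable_def by blast
  have deriv_X: "(X has_derivative (\<lambda>h. spring_lin \<alpha> \<beta> \<delta> *v h)) (at 0)"
    unfolding X_def by (rule has_derivative_spring_field[OF nz])
  then have A: "A = spring_lin \<alpha> \<beta> \<delta>"
    unfolding A_def by (rule jacobian_eqI)
  have equil: "equilibrium X 0"
    unfolding X_def equilibrium_def hamiltonian_field_def gradient_eqI[OF GDERIV_spring_H[OF nz]]
    by (simp add: vec_eq_iff forall_4 matrix_vector_mult_def sum_4 sympl_J_def spring_grad_def)
  have charpoly: "\<forall>z. det (map_matrix complex_of_real A - mat z) =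
      z^4 + complex_of_real ?b * z^2 + complex_of_real ?c"
    unfolding A using det_spring_lin[OF nz] by blast
  \<comment> \<open>The positive term \<open>1 / \<alpha>\<close> is what makes the discriminant
    strictly positive, even when \<open>?c\<close> equals 1.\<close>
  have "?b = 1 + 1 / \<alpha> + ?c"
    using nz by (simp add: field_simps)
  then have "?b > 1 + ?c"
    using \<open>\<alpha> > 0\<close> by simp
  moreover have c_pos: "?c > 0 \<longleftrightarrow> \<delta> > 0"
    using assms(1,2) by (simp add: zero_less_divide_iff mult_less_0_iff)
  ultimately have roots: "(\<exists>\<sigma>1 \<sigma>2 :: real. \<sigma>1 \<noteq> \<sigma>2 \<and> \<sigma>1 > 0 \<and> \<sigma>2 > 0 \<and>
      {\<sigma>::complex. \<sigma>^2 - complex_of_real ?b * \<sigma> + complex_of_real ?c = 0} =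
      {complex_of_real \<sigma>1, complex_of_real \<sigma>2}) \<longleftrightarrow> \<delta> > 0"
    using quadratic_two_positive_roots_iff[of ?c ?b] by simp
  have "eigenvalues A = {z. z^4 + complex_of_real ?b * z\<^sup>2 + complex_of_real ?c = 0}"
    using charpoly by (auto simp only: mem_eigenvalues_iff)
  then have eigen: "card (eigenvalues A) = 4 \<and>
      (\<forall>z\<in>eigenvalues A. \<exists>\<omega>::real. \<omega> \<noteq> 0 \<and> z = \<i> * complex_of_real \<omega>)" if "\<delta> > 0"
    using iffD2[OF roots that] biquadratic_imaginary_roots[where b = ?b and c = ?c] by metis
  have "linearly_stable X 0" if "\<delta> > 0"
    using lyapunov_stable_spring_lin[OF assms(1,2) that] equil A
    unfolding linearly_stable_def A_def by simp
  with diff_H deriv_X equil charpoly roots eigen show ?thesis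
    unfolding differentiable_def by blast
qed

end
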